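(* Let $m\ge3$ be an integer that is not square-free (i.e. $m$ is divisible by $d^2$ for some integer $d>1$), and let $\Phi_m(x)$ denote the $m$th cyclotomic polynomial. Then for every complex $z\ne 0$, $$\prod_{k=1}^\infty\Phi_m\left(\tfrac zk\right)=\frac{1}{z^{\varphi(m)}}\prod_{\substack{1\le j\le m-1\\ \gcd(j,m)=1}}\frac{1}{\Gamma(-ze^{2\pi ij/m})}=\prod_{\substack{1\le j\le m-1\\ \gcd(j,m)=1}}\frac{1}{\Gamma(1-ze^{2\pi ij/m})}.$$
   Context: $\varphi$ is Euler's totient function. The infinite product denotes the limit of its partial products (the value $0$ is allowed). The function $1/\Gamma$ is the entire function that vanishes at $0,-1,-2,\ldots$. *)

theory Defs
  imports
    "HOL-Analysis.Analysis"
    "HOL-Computational_Algebra.Squarefree"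
    "HOL-Number_Theory.Totient"
begin

definition cyclotomic_poly :: "nat \<Rightarrow> complex poly" where
  "cyclotomic_poly m =
     (\<Prod>j | 1 \<le> j \<and> j \<le> m \<and> gcd j m = 1.
        [:- exp (2 * complex_of_real pi * \<i> * of_nat j / of_nat m), 1:])"

end

theory Submission
  imports Defs
begin

text \<open>
  Let \<open>\<zeta>\<close> range over the primitive \<open>m\<close>-th roots of unity. If \<open>d\<^sup>2\<close> divides \<open>m\<close>, multiplication by
  \<open>exp (2\<pi>i/d) \<noteq> 1\<close> permutes them, so they sum to \<open>0\<close>; since \<open>m \<ge> 3\<close>, inversion pairs them without
  fixed points, so the product of the \<open>-\<zeta>\<close> is \<open>1\<close> and \<open>\<Phi>\<^sub>m(x)\<close> is the product of the \<open>1 - x\<zeta>\<close>.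
  In the product over all \<open>\<zeta>\<close> of Gauss's approximations
  \<open>n\<^bsup>z\<zeta>\<^esup> (-z\<zeta>)(1-z\<zeta>)\<dots>(n-z\<zeta>) / n!\<close> to \<open>1/\<Gamma>(-z\<zeta>)\<close> the powers of \<open>n\<close> therefore cancel, and
  what is left is \<open>z\<^bsup>\<phi>(m)\<^esup>\<close> times the \<open>n\<close>-th partial product.
\<close>

definition unity_root :: "nat \<Rightarrow> nat \<Rightarrow> complex" where
  "unity_root m j = exp (2 * complex_of_real pi * \<i> * of_nat j / of_nat m)"

lemma unity_root_add: "unity_root m (j + k) = unity_root m j * unity_root m k"
  by (simp add: unity_root_def flip: exp_add) (simp add: ring_distribs add_divide_distrib)

lemma unity_root_eq_iff:
  assumes "m > 0"
  shows "unity_root m j = unity_root m k \<longleftrightarrow> j mod m = k mod m"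
  using complex_root_unity_eq[of m j k] assms by (simp add: unity_root_def)

lemma unity_root_0: "unity_root m 0 = 1"
  by (simp add: unity_root_def)

lemma unity_root_mult_complement:
  assumes "m > 0" "j \<le> m"
  shows "unity_root m (m - j) * unity_root m j = 1"
proof -
  have "unity_root m (m - j) * unity_root m j = unity_root m m"
    using assms by (simp flip: unity_root_add)
  also have "\<dots> = unity_root m 0"
    using assms by (simp add: unity_root_eq_iff)
  finally show ?thesis
    by (simp add: unity_root_0)
qed

text \<open>\<open>totatives m\<close> runs up to \<open>m\<close>, while the products in the
  theorem stop at \<open>m - 1\<close>. The index \<open>m\<close> drops out because
  \<open>gcd m m = m > 1\<close>.\<close>

lemma totatives_eq_atMost_pred:
  assumes "m > 1"
  shows "totatives m = {j. 1 \<le> j \<and> j \<le> m - 1 \<and> gcd j m = 1}"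
  using assms totatives_less[of _ m] by (force simp: totatives_def coprime_iff_gcd_eq_1)

text \<open>On exponents this is the inversion of primitive roots. For \<open>m = 1\<close> it would
  send the totative 1 to 0, which is not a totative.\<close>

lemma bij_betw_totatives_complement:
  assumes "m > 1"
  shows "bij_betw (\<lambda>j. m - j) (totatives m) (totatives m)"
proof (rule bij_betwI[where g = "\<lambda>j. m - j"])
  have *: "m - j \<in> totatives m" if "j \<in> totatives m" for j
  proof -
    have "j < m" "coprime j m"
      using that assms totatives_less by (auto simp: in_totatives_iff)
    then have "coprime (m - j) m"
      using gcd_diff2_nat[of j m] by (simp only: coprime_iff_gcd_eq_1 less_imp_le gcd.commute)
    then show ?thesis
      using \<open>j < m\<close> by (simp add: in_totatives_iff)
  qed
  then show "(\<lambda>j. m - j) \<in> totatives m \<rightarrow> totatives m" "(\<lambda>j. m - j) \<in> totatives m \<rightarrow> totatives m"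
    by auto
qed (auto simp: in_totatives_iff)

lemma prod_minus_unity_root:
  assumes "m \<ge> 3"
  shows "(\<Prod>j\<in>totatives m. - unity_root m j) = 1"
proof -
  let ?f = "\<lambda>j. - unity_root m j"
  define A where "A = {j \<in> totatives m. 2 * j < m}"
  define B where "B = {j \<in> totatives m. 2 * j > m}"
  have bij: "bij_betw (\<lambda>j. m - j) (totatives m) (totatives m)"
    using assms by (intro bij_betw_totatives_complement) auto
  \<comment> \<open>No root is its own inverse: a totative that divides \<open>m\<close> is 1, and
    \<open>2 * 1 = m\<close> contradicts \<open>m \<ge> 3\<close>. Hence \<open>A\<close> and
    \<open>B\<close> exhaust the totatives, and inversion exchanges them.\<close>
  have "2 * j \<noteq> m" if "j \<in> totatives m" for j
  proof
    assume "2 * j = m"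
    then have "j dvd m" by auto
    with that have "j = 1"
      by (auto simp: in_totatives_iff coprime_absorb_left)
    with \<open>2 * j = m\<close> assms show False by simp
  qed
  then have un: "totatives m = A \<union> B"
    by (force simp: A_def B_def)
  have mem: "m - j \<in> totatives m" "j < m" if "j \<in> totatives m" for j
    using bij_betwE[OF bij] that totatives_less[OF that] assms by auto
  have B: "(\<Prod>j\<in>B. ?f j) = (\<Prod>j\<in>A. ?f (m - j))"
    by (rule prod.reindex_bij_witness[where i = "\<lambda>j. m - j" and j = "\<lambda>j. m - j"])
       (auto simp: A_def B_def dest: mem)
  have "(\<Prod>j\<in>totatives m. ?f j) = (\<Prod>j\<in>A. ?f j) * (\<Prod>j\<in>B. ?f j)"
    unfolding un by (rule prod.union_disjoint) (auto simp: A_def B_def)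
  also have "\<dots> = (\<Prod>j\<in>A. unity_root m (m - j) * unity_root m j)"
    by (simp add: B mult.commute flip: prod.distrib)
  also have "\<dots> = 1"
    using assms by (intro prod.neutral) (auto simp: A_def unity_root_mult_complement dest!: mem(2))
  finally show ?thesis .
qed

lemma sum_unity_root_totatives_eq_0:
  assumes "\<not> squarefree m" "m > 0"
  shows "(\<Sum>j\<in>totatives m. unity_root m j) = 0"
proof -
  obtain d where d: "d\<^sup>2 dvd m" "d \<noteq> 1"
    using assms by (auto simp: squarefree_def)
  then obtain c where c: "m = d\<^sup>2 * c" by auto
  \<comment> \<open>\<open>q\<close> is \<open>m / d\<close>, so adding \<open>q\<close> to an
    exponent multiplies the root by exp(2 pi i/d).\<close>
  define q where "q = d * c"
  have m: "m = d * q" using c by (simp add: q_def power2_eq_square)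
  have pos: "d > 1" "q > 0"
    using d assms m by (cases "d = 0"; cases "q = 0"; simp)+
  have "q < m" using pos m by simp
  have "m > 1" using pos \<open>q < m\<close> by linarith
  define g where "g = (\<lambda>j. (j + q) mod m)"
  have "g ` totatives m \<subseteq> totatives m"
  proof safe
    fix j assume j: "j \<in> totatives m"
    have "coprime (j + q) m"
    proof (rule ccontr)
      assume "\<not> coprime (j + q) m"
      then obtain p where p: "prime p" "p dvd j + q" "p dvd m"
        using prime_factor_nat[of "gcd (j + q) m"] by (auto simp: coprime_iff_gcd_eq_1)
      \<comment> \<open>This is where the square enters: \<open>m = d * q\<close> and
        \<open>q\<close> still contains a factor \<open>d\<close>, so every prime divisor of
        \<open>m\<close> divides \<open>q\<close>.\<close>
      then have "p dvd q"
        by (auto simp: m q_def prime_dvd_mult_iff)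
      with p have "p dvd j"
        by (simp add: dvd_add_left_iff)
      with p j show False
        by (auto simp: in_totatives_iff dest: coprime_common_divisor)
    qed
    then have "coprime (g j) m"
      using assms by (simp add: g_def)
    \<comment> \<open>Reduction mod \<open>m\<close> could give 0, which \<open>totatives\<close>
      excludes; but 0 is coprime to \<open>m\<close> only for \<open>m = 1\<close>.\<close>
    moreover from this have "g j \<noteq> 0"
      using \<open>m > 1\<close> by (intro notI) simp
    ultimately show "g j \<in> totatives m"
      using assms by (simp add: in_totatives_iff g_def less_imp_le)
  qed
  moreover have inj: "inj_on g (totatives m)"
  proof (rule inj_onI)
    fix j k assume jk: "j \<in> totatives m" "k \<in> totatives m" "g j = g k"
    then have "[j + q = k + q] (mod m)" by (simp add: g_def cong_def)
    then have "j mod m = k mod m" by (simp only: cong_add_rcancel_nat) (simp add: cong_def)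
    moreover have "j < m" "k < m" using jk totatives_less \<open>m > 1\<close> by blast+
    ultimately show "j = k" by simp
  qed
  ultimately have bij: "bij_betw g (totatives m) (totatives m)"
    by (simp add: bij_betw_def endo_inj_surj)
  have "unity_root m (g j) = unity_root m q * unity_root m j" for j
  proof -
    have "unity_root m (g j) = unity_root m (q + j)"
      using assms by (simp add: unity_root_eq_iff g_def add.commute)
    then show ?thesis by (simp add: unity_root_add)
  qed
  then have "(\<Sum>j\<in>totatives m. unity_root m j) =
               unity_root m q * (\<Sum>j\<in>totatives m. unity_root m j)"
    using sum.reindex_bij_betw[OF bij, of "unity_root m"] by (simp add: sum_distrib_left)
  moreover have "unity_root m q \<noteq> unity_root m 0"
    using assms pos \<open>q < m\<close> by (simp add: unity_root_eq_iff)
  ultimately show ?thesis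
    by (simp add: unity_root_0)
qed

text \<open>After replacing each root by its inverse, a factor x - 1/\<zeta> equals -(1/\<zeta>) (1
  - x \<zeta>), and the constants -(1/\<zeta>) multiply to 1.\<close>

lemma poly_cyclotomic_poly:
  assumes "m \<ge> 3"
  shows "poly (cyclotomic_poly m) x = (\<Prod>j\<in>totatives m. 1 - x * unity_root m j)"
proof -
  have T: "{j. 1 \<le> j \<and> j \<le> m \<and> gcd j m = 1} = totatives m"
    by (auto simp: totatives_def coprime_iff_gcd_eq_1)
  have bij: "bij_betw (\<lambda>j. m - j) (totatives m) (totatives m)"
    using assms by (intro bij_betw_totatives_complement) auto
  have "poly (cyclotomic_poly m) x = (\<Prod>j\<in>totatives m. x - unity_root m j)"
    unfolding cyclotomic_poly_def T by (simp add: poly_prod unity_root_def)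
  also have "\<dots> = (\<Prod>j\<in>totatives m. x - unity_root m (m - j))"
    by (rule prod.reindex_bij_betw[OF bij, symmetric])
  also have "\<dots> = (\<Prod>j\<in>totatives m. - unity_root m (m - j) * (1 - x * unity_root m j))"
  proof (rule prod.cong[OF refl])
    fix j assume "j \<in> totatives m"
    then have "unity_root m (m - j) * unity_root m j = 1"
      using assms by (intro unity_root_mult_complement) (auto simp: in_totatives_iff)
    then show "x - unity_root m (m - j) = - unity_root m (m - j) * (1 - x * unity_root m j)"
      by (simp add: algebra_simps)
  qed
  also have "\<dots> = (\<Prod>j\<in>totatives m. 1 - x * unity_root m j)"
    using prod.reindex_bij_betw[OF bij, of "\<lambda>j. - unity_root m j"] prod_minus_unity_root[OF assms]
    unfolding prod.distrib by simp
  finally show ?thesis .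
qed

text \<open>The first pochhammer factor is split off as \<open>- w\<close>, the factorial is
  distributed over the other \<open>n\<close> factors, and the exponential is the power of
  \<open>n\<close> that has to cancel later.\<close>

lemma rGamma_series_minus:
  "rGamma_series (- w :: complex) n =
     - w * (\<Prod>k=1..n. 1 - w / of_nat k) * exp (of_real (ln (real n)) * w)"
proof -
  have "pochhammer (- w) (n + 1) = - w * (\<Prod>k=1..n. of_nat k - w)"
    unfolding Suc_eq_plus1[symmetric] pochhammer_rec
    by (simp add: pochhammer_prod prod.atLeast1_atMost_eq atLeast0LessThan algebra_simps)
  moreover have "(\<Prod>k=1..n. of_nat k - w) = fact n * (\<Prod>k=1..n. 1 - w / of_nat k)"
    unfolding fact_prod of_nat_prod prod.distrib[symmetric]
    by (intro prod.cong) (auto simp: field_simps)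
  ultimately show ?thesis
    by (simp add: rGamma_series_def exp_minus field_simps)
qed

theorem theorem6:
  fixes m :: nat and z :: complex
  assumes "m \<ge> 3" and "\<not> squarefree m" and "z \<noteq> 0"
  shows "((\<lambda>n. \<Prod>k=1..n. poly (cyclotomic_poly m) (z / of_nat k)) \<longlonglongrightarrow>
            1 / z ^ totient m *
            (\<Prod>j | 1 \<le> j \<and> j \<le> m - 1 \<and> gcd j m = 1.
               rGamma (- z * exp (2 * complex_of_real pi * \<i> * of_nat j / of_nat m)))) \<and>
         1 / z ^ totient m *
            (\<Prod>j | 1 \<le> j \<and> j \<le> m - 1 \<and> gcd j m = 1.
               rGamma (- z * exp (2 * complex_of_real pi * \<i> * of_nat j / of_nat m))) =
            (\<Prod>j | 1 \<le> j \<and> j \<le> m - 1 \<and> gcd j m = 1.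
               rGamma (1 - z * exp (2 * complex_of_real pi * \<i> * of_nat j / of_nat m)))"
proof -
  let ?T = "totatives m" and ?\<zeta> = "unity_root m"
  have T: "{j. 1 \<le> j \<and> j \<le> m - 1 \<and> gcd j m = 1} = ?T"
    using totatives_eq_atMost_pred[of m] assms by simp
  have lin: "(\<Prod>j\<in>?T. - (z * ?\<zeta> j)) = z ^ totient m"
  proof -
    have "(\<Prod>j\<in>?T. - (z * ?\<zeta> j)) = (\<Prod>j\<in>?T. z * (- ?\<zeta> j))" by simp
    also have "\<dots> = z ^ totient m"
      unfolding prod.distrib prod_minus_unity_root[OF assms(1)] by (simp add: totient_def)
    finally show ?thesis .
  qed
  have series: "(\<Prod>j\<in>?T. rGamma_series (- (z * ?\<zeta> j)) n) =
      z ^ totient m * (\<Prod>k=1..n. poly (cyclotomic_poly m) (z / of_nat k))" for n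
  proof -
    have "(\<Prod>j\<in>?T. exp (complex_of_real (ln (real n)) * (z * ?\<zeta> j))) =
            exp (complex_of_real (ln (real n)) * z * (\<Sum>j\<in>?T. ?\<zeta> j))"
      by (simp add: exp_sum sum_distrib_left mult.assoc)
    also have "\<dots> = 1"
      using assms by (simp add: sum_unity_root_totatives_eq_0)
    finally have "(\<Prod>j\<in>?T. rGamma_series (- (z * ?\<zeta> j)) n) =
            z ^ totient m * (\<Prod>j\<in>?T. \<Prod>k=1..n. 1 - z * ?\<zeta> j / of_nat k)"
      unfolding rGamma_series_minus prod.distrib lin by simp
    \<comment> \<open>Swapping the products collects, for each \<open>k\<close>, the factors of the
      cyclotomic polynomial at \<open>z / k\<close>.\<close>
    also have "(\<Prod>j\<in>?T. \<Prod>k=1..n. 1 - z * ?\<zeta> j / of_nat k) =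
               (\<Prod>k=1..n. \<Prod>j\<in>?T. 1 - z / of_nat k * ?\<zeta> j)"
      by (subst prod.swap) simp
    finally show ?thesis
      by (simp add: poly_cyclotomic_poly[OF assms(1)])
  qed
  have "(\<lambda>n. 1 / z ^ totient m * (\<Prod>j\<in>?T. rGamma_series (- (z * ?\<zeta> j)) n)) \<longlonglongrightarrow>
          1 / z ^ totient m * (\<Prod>j\<in>?T. rGamma (- (z * ?\<zeta> j)))"
    by (intro tendsto_intros)
  then have "(\<lambda>n. \<Prod>k=1..n. poly (cyclotomic_poly m) (z / of_nat k)) \<longlonglongrightarrow>
               1 / z ^ totient m * (\<Prod>j\<in>?T. rGamma (- (z * ?\<zeta> j)))"
    using assms by (simp add: series)
  moreover have "1 / z ^ totient m * (\<Prod>j\<in>?T. rGamma (- (z * ?\<zeta> j))) =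
                   (\<Prod>j\<in>?T. rGamma (1 - z * ?\<zeta> j))"
  proof -
    have "(\<Prod>j\<in>?T. rGamma (- (z * ?\<zeta> j))) =
            (\<Prod>j\<in>?T. - (z * ?\<zeta> j) * rGamma (1 - z * ?\<zeta> j))"
      \<comment> \<open>The functional equation of the entire function 1/\<Gamma> holds at every
        point, so the zeros at integers need no separate case.\<close>
      by (intro prod.cong refl) (use rGamma_plus1[of "- (z * ?\<zeta> _)"] in simp)
    also have "\<dots> = z ^ totient m * (\<Prod>j\<in>?T. rGamma (1 - z * ?\<zeta> j))"
      unfolding prod.distrib lin ..
    finally show ?thesis
      using assms by simp
  qed
  ultimately show ?thesis
    unfolding T by (simp add: unity_root_def)
qed

end
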